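(* Let $\Sigma$ be a finite complete simplicial fan in $N$, let $\sigma\in\Sigma$ with $2\le\dim\sigma\le d$, and let $x$ be a primitive element of $N$ with $x\in(\mathrm{Relint}(\sigma))\cap N$. Then the primitive collections of the star subdivision $\Sigma^{\ast}_{(\sigma,x)}$ are exactly the following: (1) $\mathrm{G}(\sigma)$; (2) those $P\in\mathrm{PC}(\Sigma)$ such that $\mathrm{G}(\sigma)\not\subset P$; (3) the minimal elements (with respect to inclusion) of the set $\{(P\setminus\mathrm{G}(\sigma))\cup\{x\} \mid P\in\mathrm{PC}(\Sigma),\ P\cap\mathrm{G}(\sigma)\neq\emptyset\}$.
   Context: $N$ is a free abelian group of rank $d$, $N_{\mathbf R}=N\otimes_{\mathbf Z}\mathbf R$. For a finite complete fan $\Sigma$ in $N$, $\mathrm{G}(\Sigma)$ is the set of primitive generators (in $N$) of the one-dimensional cones of $\Sigma$, and $\mathrm{G}(\sigma)=\sigma\cap\mathrm{G}(\Sigma)$ for $\sigma\in\Sigma$. For $S\subset N_{\mathbf R}$, $\mathrm{Cone}(S)=\sum_{s\in S}\mathbf R_{\ge0}s$, and $\mathrm{Relint}$ denotes relative interior. The fan is simplicial if every cone is generated by linearly independent vectors. $\sigma\prec\tau$ means that $\sigma$ is a face of $\tau$. Primitive collections: for a finite complete simplicial fan $\Sigma$, a nonempty subset $P\subset\mathrm{G}(\Sigma)$ is a primitive collection of $\Sigma$ if $\mathrm{Cone}(P)\notin\Sigma$ while $\mathrm{Cone}(P\setminus\{y\})\in\Sigma$ for every $y\in P$. $\mathrm{PC}(\Sigma)$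 is the set of primitive collections of $\Sigma$. Star subdivision: let $\Sigma$ be finite complete simplicial, $\sigma\in\Sigma$ with $\dim\sigma=l$, $2\le l\le d$, $\mathrm{G}(\sigma)=\{x_1,\dots,x_l\}$, and $x\in\mathrm{Relint}(\sigma)\cap N$ primitive in $N$. Put $\sigma_i=\mathrm{Cone}(\{x_1,\dots,x_{i-1},x,x_{i+1},\dots,x_l\})$ for $1\le i\le l$. Each $\tau\in\Sigma$ with $\sigma\prec\tau$ is written uniquely as $\tau=\sigma+\tau'$ with $\tau'\in\Sigma$, $\sigma\cap\tau'=\{0\}$. The star subdivision of $\Sigma$ along $(\sigma,x)$ is the finite complete simplicial fan $$\Sigma^{\ast}_{(\sigma,x)}=(\Sigma\setminus\{\tau\in\Sigma\mid\sigma\prec\tau\})\cup\{\text{the faces of }\sigma_i+\tau'\mid\tau=\sigma+\tau'\in\Sigma,\ \sigma\prec\tau,\ 1\le i\le l\}.$$ *)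

theory Defs
  imports "HOL-Analysis.Analysis"
begin

(* A free abelian group N of rank d is given together with N \<otimes> R as the integral span of
   a basis of a d-dimensional real space 'a.  The inner product of 'a plays no role. *)
definition full_lattice :: "'a::euclidean_space set \<Rightarrow> bool" where
  "full_lattice N \<longleftrightarrow>
     (\<exists>B. independent B \<and> span B = UNIV \<and>
          N = {\<Sum>b\<in>B. of_int (c b) *\<^sub>R b | c :: 'a \<Rightarrow> int. True})"

definition primitive_in :: "'a::euclidean_space set \<Rightarrow> 'a \<Rightarrow> bool" where
  "primitive_in N v \<longleftrightarrow>
     v \<in> N \<and> v \<noteq> 0 \<and> \<not> (\<exists>w\<in>N. \<exists>k::nat. k \<ge> 2 \<and> v = of_nat k *\<^sub>R w)"

(* Finite nonnegative combinations, so that Cone {} = {0}.  Not the library's cone hull,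
   which is only closed under scaling; see Cone_eq_convex_cone_hull below. *)
definition Cone :: "'a::real_vector set \<Rightarrow> 'a set" where
  "Cone S = {\<Sum>s\<in>F. c s *\<^sub>R s | F c. finite F \<and> F \<subseteq> S \<and> (\<forall>s\<in>F. 0 \<le> c s)}"

lemma Cone_eq_convex_cone_hull: "Cone S = convex_cone hull S"
proof
  have "(\<Sum>s\<in>F. c s *\<^sub>R s) \<in> convex_cone hull S"
    if "finite F" "F \<subseteq> S" "\<forall>s\<in>F. 0 \<le> c s" for F and c :: "'a \<Rightarrow> real"
    using that
    by (induction F rule: finite_induct)
       (auto simp: convex_cone_hull_contains_0 hull_inc
             intro!: convex_cone_hull_add convex_cone_hull_mul)
  then show "Cone S \<subseteq> convex_cone hull S"
    by (auto simp: Cone_def)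
next
  have "convex_cone (Cone S)"
    unfolding convex_cone_iff
  proof (intro conjI ballI allI impI)
    show "0 \<in> Cone S"
      unfolding Cone_def by (auto intro!: exI[of _ "{}"])
  next
    fix x y assume "x \<in> Cone S" "y \<in> Cone S"
    then obtain F c G e where
      F: "finite F" "F \<subseteq> S" "\<forall>s\<in>F. 0 \<le> c s" "x = (\<Sum>s\<in>F. c s *\<^sub>R s)" and
      G: "finite G" "G \<subseteq> S" "\<forall>s\<in>G. 0 \<le> e s" "y = (\<Sum>s\<in>G. e s *\<^sub>R s)"
      unfolding Cone_def by blast
    define h where "h s = (if s \<in> F then c s else 0) + (if s \<in> G then e s else 0)" for s
    have "x = (\<Sum>s\<in>F \<union> G. (if s \<in> F then c s else 0) *\<^sub>R s)"
      unfolding F(4) by (rule sum.mono_neutral_cong_left) (use F G in auto)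
    moreover have "y = (\<Sum>s\<in>F \<union> G. (if s \<in> G then e s else 0) *\<^sub>R s)"
      unfolding G(4) by (rule sum.mono_neutral_cong_left) (use F G in auto)
    ultimately have "x + y = (\<Sum>s\<in>F \<union> G. h s *\<^sub>R s)"
      by (simp add: h_def scaleR_add_left sum.distrib)
    moreover have "\<forall>s\<in>F \<union> G. 0 \<le> h s"
      using F G by (auto simp: h_def)
    ultimately show "x + y \<in> Cone S"
      unfolding Cone_def using F G by blast
  next
    fix x and r :: real assume "x \<in> Cone S" "0 \<le> r"
    then obtain F c where
      F: "finite F" "F \<subseteq> S" "\<forall>s\<in>F. 0 \<le> c s" "x = (\<Sum>s\<in>F. c s *\<^sub>R s)"
      unfolding Cone_def by blast
    have "r *\<^sub>R x = (\<Sum>s\<in>F. (r * c s) *\<^sub>R s)"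
      by (simp add: F(4) scaleR_sum_right)
    moreover have "\<forall>s\<in>F. 0 \<le> r * c s"
      using F \<open>0 \<le> r\<close> by auto
    ultimately show "r *\<^sub>R x \<in> Cone S"
      unfolding Cone_def using F
      by (intro CollectI exI[of _ F] exI[of _ "\<lambda>s. r * c s"]) auto
  qed
  moreover have "S \<subseteq> Cone S"
  proof
    fix s assume "s \<in> S"
    then show "s \<in> Cone S"
      unfolding Cone_def by (intro CollectI exI[of _ "{s}"] exI[of _ "\<lambda>_. 1"]) auto
  qed
  ultimately show "convex_cone hull S \<subseteq> Cone S"
    by (simp add: hull_minimal)
qed

(* The library's face_of also admits the empty set, which is not a face of a cone. *)
definition cone_face :: "'a::real_vector set \<Rightarrow> 'a set \<Rightarrow> bool" where
  "cone_face \<sigma> \<tau> \<longleftrightarrow> \<sigma> face_of \<tau> \<and> \<sigma> \<noteq> {}"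

definition rational_cone :: "'a::euclidean_space set \<Rightarrow> 'a set \<Rightarrow> bool" where
  "rational_cone N \<sigma> \<longleftrightarrow> (\<exists>S. finite S \<and> S \<subseteq> N \<and> \<sigma> = Cone S)"

definition strongly_convex :: "'a::real_vector set \<Rightarrow> bool" where
  "strongly_convex \<sigma> \<longleftrightarrow> \<sigma> \<inter> uminus ` \<sigma> = {0}"

definition finite_fan :: "'a::euclidean_space set \<Rightarrow> 'a set set \<Rightarrow> bool" where
  "finite_fan N \<Sigma> \<longleftrightarrow>
     finite \<Sigma> \<and> \<Sigma> \<noteq> {} \<and>
     (\<forall>\<sigma>\<in>\<Sigma>. rational_cone N \<sigma> \<and> strongly_convex \<sigma>) \<and>
     (\<forall>\<sigma>\<in>\<Sigma>. \<forall>\<tau>. cone_face \<tau> \<sigma> \<longrightarrow> \<tau> \<in> \<Sigma>) \<and>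
     (\<forall>\<sigma>\<in>\<Sigma>. \<forall>\<tau>\<in>\<Sigma>. cone_face (\<sigma> \<inter> \<tau>) \<sigma> \<and> cone_face (\<sigma> \<inter> \<tau>) \<tau>)"

definition complete_fan :: "'a set set \<Rightarrow> bool" where
  "complete_fan \<Sigma> \<longleftrightarrow> \<Union>\<Sigma> = UNIV"

definition simplicial_fan :: "'a::real_vector set set \<Rightarrow> bool" where
  "simplicial_fan \<Sigma> \<longleftrightarrow> (\<forall>\<sigma>\<in>\<Sigma>. \<exists>B. independent B \<and> \<sigma> = Cone B)"

definition fan_gens :: "'a::euclidean_space set \<Rightarrow> 'a set set \<Rightarrow> 'a set" where
  "fan_gens N \<Sigma> = {v. primitive_in N v \<and> (\<exists>\<rho>\<in>\<Sigma>. dim \<rho> = 1 \<and> \<rho> = Cone {v})}"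

definition cone_gens :: "'a::euclidean_space set \<Rightarrow> 'a set set \<Rightarrow> 'a set \<Rightarrow> 'a set" where
  "cone_gens N \<Sigma> \<sigma> = \<sigma> \<inter> fan_gens N \<Sigma>"

definition PC :: "'a::euclidean_space set \<Rightarrow> 'a set set \<Rightarrow> 'a set set" where
  "PC N \<Sigma> = {P. P \<noteq> {} \<and> P \<subseteq> fan_gens N \<Sigma> \<and> Cone P \<notin> \<Sigma> \<and> (\<forall>y\<in>P. Cone (P - {y}) \<in> \<Sigma>)}"

(* The cone \<sigma>_i, indexed by the replaced generator y = x_i, is Cone (insert x (G(\<sigma>) - {y}));
   + is the Minkowski sum. *)
definition star_subdivision ::
    "'a::euclidean_space set \<Rightarrow> 'a set set \<Rightarrow> 'a set \<Rightarrow> 'a \<Rightarrow> 'a set set" where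
  "star_subdivision N \<Sigma> \<sigma> x =
     (\<Sigma> - {\<tau>\<in>\<Sigma>. cone_face \<sigma> \<tau>}) \<union>
     {\<rho>. \<exists>\<tau>\<in>\<Sigma>. \<exists>\<tau>'\<in>\<Sigma>. \<exists>y\<in>cone_gens N \<Sigma> \<sigma>.
           cone_face \<sigma> \<tau> \<and> \<tau> = \<sigma> + \<tau>' \<and> \<sigma> \<inter> \<tau>' = {0} \<and>
           cone_face \<rho> (Cone (insert x (cone_gens N \<Sigma> \<sigma> - {y})) + \<tau>')}"

definition minimal_sets :: "'a set set \<Rightarrow> 'a set set" where
  "minimal_sets \<A> = {A\<in>\<A>. \<forall>B\<in>\<A>. B \<subseteq> A \<longrightarrow> B = A}"

end

theory Submission
  imports Defs
begin

text \<open>A cone of a simplicial fan is spanned by its primitive generators, so a fan \<open>\<Sigma>\<close> is the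
same datum as the simplicial complex \<open>K\<close> of those sets \<open>S\<close> of generators with \<open>Cone S \<in> \<Sigma>\<close>, and
the primitive collections of \<open>\<Sigma>\<close> are the minimal nonfaces of \<open>K\<close>
(\<open>PC_eq_minimal_nonfaces\<close>).

Let \<open>A\<close> be the set of generators of \<open>\<sigma>\<close>. The star subdivision corresponds to the stellar
subdivision of \<open>K\<close> at the face \<open>A\<close>: its faces are the \<open>S \<in> K\<close> not containing \<open>A\<close>, and the
\<open>S \<union> {x}\<close> with \<open>S\<close> not containing \<open>A\<close> and \<open>S \<union> A \<in> K\<close> (\<open>fan_gens_star\<close> and
\<open>Cone_in_star_iff\<close>, combined in \<open>PC_star\<close>). The geometric input is that all coordinates of \<open>x\<close>
at the elements of \<open>A\<close> are strictly positive. Hence \<open>x\<close> lies in a cone of \<open>\<Sigma>\<close> only if \<open>\<sigma>\<close> is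
a face of that cone, and the new cones are simplicial and contain no generators besides those
that span them.

What remains is combinatorics (\<open>minimal_nonfaces_stellar\<close>). Among sets without \<open>x\<close>, the new
complex only drops the faces containing \<open>A\<close>; this makes \<open>A\<close> a minimal nonface and
removes the old minimal nonfaces that contain \<open>A\<close>. A set \<open>S \<union> {x}\<close> all of whose proper subsets
are faces has \<open>S \<in> K\<close> and does not contain \<open>A\<close>, so it is a nonface iff \<open>S \<union> A\<close> is not in \<open>K\<close>,
that is, iff some minimal nonface \<open>P\<close> of \<open>K\<close> satisfies \<open>P - A \<subseteq> S\<close>. Such a \<open>P\<close> must meet \<open>A\<close>,
since otherwise \<open>P \<subseteq> S\<close>. Minimality of \<open>S \<union> {x}\<close> therefore means that \<open>S\<close> is a
minimal one among the sets \<open>P - A\<close>.\<close>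

section \<open>Primitive lattice vectors\<close>

lemma full_lattice_coordinates:
  fixes N :: "'a::euclidean_space set"
  assumes "full_lattice N"
  obtains B where "independent B" "span B = UNIV"
    "N = {v. \<forall>b\<in>B. representation B v b \<in> \<int>}"
proof -
  obtain B where B: "independent B" "span B = UNIV"
    and N: "N = {\<Sum>b\<in>B. of_int (c b) *\<^sub>R b | c :: 'a \<Rightarrow> int. True}"
    using assms unfolding full_lattice_def by blast
  have fin: "finite B" using B(1) by (rule independent_imp_finite)
  have "v \<in> N \<longleftrightarrow> (\<forall>b\<in>B. representation B v b \<in> \<int>)" for v
  proof
    assume "v \<in> N"
    then obtain c :: "'a \<Rightarrow> int" where v: "v = (\<Sum>b\<in>B. of_int (c b) *\<^sub>R b)"
      unfolding N by blast
    have "representation B v b = of_int (c b)" if "b \<in> B" for b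
    proof -
      have "representation B v b = (\<Sum>a\<in>B. representation B (of_int (c a) *\<^sub>R a) b)"
        unfolding v by (subst representation_sum) (use B in auto)
      also have "\<dots> = (\<Sum>a\<in>B. if a = b then of_int (c b) else 0)"
        by (rule sum.cong) (use B in \<open>auto simp: representation_scale representation_basis\<close>)
      finally show ?thesis using that fin by simp
    qed
    then show "\<forall>b\<in>B. representation B v b \<in> \<int>" by simp
  next
    assume int: "\<forall>b\<in>B. representation B v b \<in> \<int>"
    have "v = (\<Sum>b\<in>B. representation B v b *\<^sub>R b)"
      using sum_representation_eq[OF B(1), of v B] B fin by simp
    also have "\<dots> = (\<Sum>b\<in>B. of_int \<lfloor>representation B v b\<rfloor> *\<^sub>R b)"
      using int by (intro sum.cong) (auto elim: Ints_cases)
    finally show "v \<in> N" unfolding N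
      by (intro CollectI exI[of _ "\<lambda>b. \<lfloor>representation B v b\<rfloor>"]) simp
  qed
  then show thesis using that B by blast
qed

lemma nonzero_coordinate:
  fixes v :: "'a::euclidean_space"
  assumes "independent B" "span B = UNIV" "v \<noteq> 0"
  obtains a where "a \<in> B" "representation B v a \<noteq> 0"
proof -
  have "v = (\<Sum>b\<in>B. representation B v b *\<^sub>R b)"
    using sum_representation_eq[OF assms(1), of v B] assms independent_imp_finite[OF assms(1)]
    by simp
  moreover have "(\<Sum>b\<in>B. representation B v b *\<^sub>R b) = 0"
    if "\<forall>b\<in>B. representation B v b = 0"
    using that by simp
  ultimately show thesis using that assms(3) by metis
qed

text \<open>Divide \<open>s\<close> by the largest possible positive integer. The divisors of \<open>s\<close> are bounded because
each of them divides a nonzero integral coordinate of \<open>s\<close>.\<close>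

lemma primitive_on_ray_exists:
  fixes N :: "'a::euclidean_space set"
  assumes "full_lattice N" "s \<in> N" "s \<noteq> 0"
  obtains v k where "primitive_in N v" "0 < k" "s = of_nat k *\<^sub>R v"
proof -
  obtain B where B: "independent B" "span B = UNIV"
    and N: "N = {v. \<forall>b\<in>B. representation B v b \<in> \<int>}"
    using full_lattice_coordinates[OF assms(1)] .
  have scale: "representation B (r *\<^sub>R v) b = r * representation B v b" for r v b
    using B by (simp add: representation_scale)
  obtain a where a: "a \<in> B" "representation B s a \<noteq> 0"
    using nonzero_coordinate[OF B assms(3)] .
  define K where "K = {k::nat. 0 < k \<and> (\<exists>v\<in>N. s = of_nat k *\<^sub>R v)}"
  have "k \<le> nat \<lfloor>\<bar>representation B s a\<bar>\<rfloor>" if k: "k \<in> K" for k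
  proof -
    obtain v where v: "v \<in> N" "s = of_nat k *\<^sub>R v" using k unfolding K_def by blast
    have r: "representation B s a = of_nat k * representation B v a"
      unfolding v(2) by (rule scale)
    have "representation B v a \<in> \<int>" "representation B v a \<noteq> 0"
      using v(1) a r unfolding N by auto
    then have "1 \<le> \<bar>representation B v a\<bar>" by (rule Ints_nonzero_abs_ge1)
    then have "of_nat k \<le> \<bar>representation B s a\<bar>"
      unfolding r abs_mult by (simp add: mult_le_cancel_left1)
    then show ?thesis by linarith
  qed
  then have finK: "finite K" by (meson finite_nat_set_iff_bounded_le)
  have "1 \<in> K" unfolding K_def using assms by auto
  then have M: "Max K \<in> K" using Max_in[OF finK] by blast
  then obtain v where v: "v \<in> N" "s = of_nat (Max K) *\<^sub>R v" and pos: "0 < Max K"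
    unfolding K_def by blast
  have "primitive_in N v" unfolding primitive_in_def
  proof (intro conjI notI)
    show "v \<in> N" by fact
    show False if "v = 0" using that v assms(3) by simp
    assume "\<exists>w\<in>N. \<exists>k::nat. k \<ge> 2 \<and> v = of_nat k *\<^sub>R w"
    then obtain w and k :: nat where w: "w \<in> N" "k \<ge> 2" "v = of_nat k *\<^sub>R w" by blast
    then have "0 < Max K * k" "s = of_nat (Max K * k) *\<^sub>R w"
      using v(2) pos by simp_all
    then have "Max K * k \<in> K" unfolding K_def using w(1) by blast
    then have "Max K * k \<le> Max K" using finK by simp
    then show False using w(2) pos by simp
  qed
  then show thesis using that v pos by blast
qed

text \<open>Comparing a nonzero integral coordinate of both vectors shows that their ratio is
rational; a reduced fraction \<open>m / n\<close> with \<open>m > 1\<close> or \<open>n > 1\<close> would divide one of them in the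
lattice.\<close>

lemma primitive_on_ray_unique:
  fixes N :: "'a::euclidean_space set"
  assumes "full_lattice N" "primitive_in N v" "primitive_in N w" "v = t *\<^sub>R w" "0 \<le> t"
  shows "v = w"
proof -
  obtain B where B: "independent B" "span B = UNIV"
    and N: "N = {v. \<forall>b\<in>B. representation B v b \<in> \<int>}"
    using full_lattice_coordinates[OF assms(1)] .
  have scale: "representation B (r *\<^sub>R v) b = r * representation B v b" for r v b
    using B by (simp add: representation_scale)
  have vN: "v \<in> N" "w \<in> N" "v \<noteq> 0" "w \<noteq> 0" using assms unfolding primitive_in_def by auto
  then have t: "0 < t" using assms(4,5) by (cases "t = 0") auto
  obtain a where a: "a \<in> B" "representation B w a \<noteq> 0"
    using nonzero_coordinate[OF B vN(4)] .
  have "t = representation B v a / representation B w a"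
    using a by (simp add: assms(4) scale)
  moreover have "representation B v a \<in> \<rat>" "representation B w a \<in> \<rat>"
    using vN a(1) Ints_subset_Rats unfolding N by auto
  ultimately have "t \<in> \<rat>" by simp
  then obtain m n :: nat where mn: "n \<noteq> 0" "\<bar>t\<bar> = real m / real n" "coprime m n"
    by (rule Rats_abs_nat_div_natE)
  then have tmn: "t = real m / real n" using t by simp
  have "(1 / real n) *\<^sub>R w \<in> N" unfolding N
  proof (intro CollectI ballI)
    fix b assume b: "b \<in> B"
    obtain i j where ij: "representation B v b = of_int i" "representation B w b = of_int j"
      using vN(1,2) b unfolding N by (metis (mono_tags, lifting) Ints_cases mem_Collect_eq)
    have "of_int i = t * of_int j" using ij scale[of t w b] assms(4) by simp
    then have "real_of_int (int n * i) = real_of_int (int m * j)"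
      using mn(1) by (simp add: tmn field_simps)
    then have "int n * i = int m * j" by linarith
    then have "int n dvd j" using mn(3)
      by (metis coprime_commute coprime_dvd_mult_right_iff coprime_int_iff dvd_triv_left)
    then obtain l where "j = int n * l" by blast
    then show "representation B ((1 / real n) *\<^sub>R w) b \<in> \<int>"
      using mn(1) by (simp add: scale ij)
  qed
  moreover have "w = of_nat n *\<^sub>R ((1 / real n) *\<^sub>R w)" using mn(1) by simp
  ultimately have "\<not> n \<ge> 2" using assms(3) unfolding primitive_in_def by blast
  then have n: "n = 1" using mn(1) by simp
  then have vm: "v = of_nat m *\<^sub>R w" using assms(4) tmn by simp
  then have "\<not> m \<ge> 2" using assms(2) vN unfolding primitive_in_def by blast
  moreover have "m \<noteq> 0" using vm vN by auto
  ultimately have "m = 1" by simp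
  then show ?thesis using vm by simp
qed

section \<open>Cones and their faces\<close>

lemma convex_cone_Cone: "convex_cone (Cone S)"
  by (simp add: Cone_eq_convex_cone_hull convex_cone_convex_cone_hull)

lemma Cone_superset: "S \<subseteq> Cone S"
  by (simp add: Cone_eq_convex_cone_hull hull_subset)

lemma Cone_scale: "0 \<le> r \<Longrightarrow> z \<in> Cone S \<Longrightarrow> r *\<^sub>R z \<in> Cone S"
  using convex_cone_Cone[of S] unfolding convex_cone_iff by blast

lemma Cone_add: "y \<in> Cone S \<Longrightarrow> z \<in> Cone S \<Longrightarrow> y + z \<in> Cone S"
  using convex_cone_Cone[of S] unfolding convex_cone_iff by blast

lemma Cone_mono: "S \<subseteq> T \<Longrightarrow> Cone S \<subseteq> Cone T"
  by (simp add: Cone_eq_convex_cone_hull hull_mono)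

lemma Cone_minimal: "S \<subseteq> C \<Longrightarrow> convex_cone C \<Longrightarrow> Cone S \<subseteq> C"
  by (simp add: Cone_eq_convex_cone_hull hull_minimal)

lemma Cone_Un: "Cone (S \<union> T) = Cone S + Cone T"
  unfolding Cone_eq_convex_cone_hull convex_cone_hull_Un set_plus_def by blast

lemma Cone_empty: "Cone {} = {0}"
  by (auto simp: Cone_def)

lemma Cone_singleton_iff: "z \<in> Cone {v} \<longleftrightarrow> (\<exists>t\<ge>0. z = t *\<^sub>R v)"
proof
  assume "z \<in> Cone {v}"
  then obtain F c where F: "F \<subseteq> {v}" "\<forall>s\<in>F. 0 \<le> c s" "z = (\<Sum>s\<in>F. c s *\<^sub>R s)"
    unfolding Cone_def by blast
  from F(1) consider "F = {}" | "F = {v}" by blast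
  then show "\<exists>t\<ge>0. z = t *\<^sub>R v"
  proof cases
    case 1 then show ?thesis using F by (intro exI[of _ 0]) auto
  next
    case 2 then show ?thesis using F by auto
  qed
next
  assume "\<exists>t\<ge>0. z = t *\<^sub>R v"
  then show "z \<in> Cone {v}"
    using convex_cone_Cone[of "{v}"] Cone_superset[of "{v}"] unfolding convex_cone_iff by auto
qed

lemma dim_Cone: "dim (Cone S) = dim (S::'a::euclidean_space set)"
proof (rule antisym)
  have "convex_cone (span S)"
    unfolding convex_cone_iff by (auto intro: span_0 span_add span_mul)
  then have "Cone S \<subseteq> span S" by (intro Cone_minimal span_superset)
  then show "dim (Cone S) \<le> dim S" by (metis dim_span dim_subset)
  show "dim S \<le> dim (Cone S)" by (rule dim_subset[OF Cone_superset])
qed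

text \<open>Inside the cone over a basis, the subcones over parts of the basis are cut out by
vanishing of coordinates. Facts on faces and intersections of such subcones reduce to this.\<close>

lemma mem_Cone_iff_coordinates:
  fixes B :: "'a::euclidean_space set"
  assumes B: "independent B" and "S \<subseteq> B"
  shows "z \<in> Cone S \<longleftrightarrow> z \<in> span B \<and> (\<forall>b\<in>B. 0 \<le> representation B z b)
    \<and> (\<forall>b\<in>B - S. representation B z b = 0)" (is "?l \<longleftrightarrow> ?r z")
proof
  have "convex_cone {z. ?r z}"
    unfolding convex_cone_iff using B
    by (auto simp: span_0 span_add span_mul representation_add representation_scale
        representation_zero)
  moreover have "S \<subseteq> {z. ?r z}"
    using assms by (auto simp: span_base representation_basis)
  ultimately have "Cone S \<subseteq> {z. ?r z}" by (intro Cone_minimal)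
  then show "?l \<Longrightarrow> ?r z" by blast
next
  assume r: "?r z"
  have fin: "finite B" using B by (rule independent_imp_finite)
  have "z = (\<Sum>b\<in>B. representation B z b *\<^sub>R b)"
    using sum_representation_eq[OF B, of z B] r fin by simp
  also have "\<dots> = (\<Sum>b\<in>S. representation B z b *\<^sub>R b)"
    by (rule sum.mono_neutral_right) (use fin assms r in auto)
  finally have "z = (\<Sum>b\<in>S. representation B z b *\<^sub>R b)" .
  moreover have "finite S" using fin assms by (simp add: finite_subset)
  ultimately show ?l unfolding Cone_def using r assms(2) by blast
qed

lemma Cone_Int:
  fixes B :: "'a::euclidean_space set"
  assumes "independent B" "S \<subseteq> B" "T \<subseteq> B"
  shows "Cone S \<inter> Cone T = Cone (S \<inter> T)"
proof -
  have "S \<inter> T \<subseteq> B" using assms by blast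
  then show ?thesis using assms by (auto simp: mem_Cone_iff_coordinates)
qed

lemma mem_Cone_independent:
  fixes B :: "'a::euclidean_space set"
  assumes "independent B" "S \<subseteq> B" "b \<in> B" "b \<in> Cone S"
  shows "b \<in> S"
proof (rule ccontr)
  assume "b \<notin> S"
  then have "representation B b b = 0" using assms by (simp add: mem_Cone_iff_coordinates)
  then show False using assms by (simp add: representation_basis)
qed

lemma cone_face_convex_cone:
  assumes "cone_face F (Cone S)"
  shows "convex_cone F"
proof -
  have face: "F face_of Cone S" and "F \<noteq> {}" using assms unfolding cone_face_def by auto
  have sub: "F \<subseteq> Cone S" using face by (rule face_of_imp_subset)
  have conv: "convex F" using face by (rule face_of_imp_convex)
  have zero_Cone: "0 \<in> Cone S" using convex_cone_Cone[of S] unfolding convex_cone_iff by blast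
  have stretch: "0 \<in> F \<and> (r + 2) *\<^sub>R z \<in> F" if "z \<in> F" "0 \<le> r" for z and r :: real
  proof (cases "z = 0")
    case True then show ?thesis using that by simp
  next
    case False
    have "z = (1 - 1 / (r + 2)) *\<^sub>R 0 + (1 / (r + 2)) *\<^sub>R ((r + 2) *\<^sub>R z)" using that by simp
    moreover have "0 \<noteq> (r + 2) *\<^sub>R z" "0 < 1 / (r + 2)" "1 / (r + 2) < 1"
      using False that by auto
    ultimately have "z \<in> open_segment 0 ((r + 2) *\<^sub>R z)"
      unfolding in_segment by blast
    moreover have "z \<in> Cone S" using sub that by blast
    moreover from this have "(r + 2) *\<^sub>R z \<in> Cone S" using that by (intro Cone_scale) auto
    ultimately show ?thesis using face_ofD[OF face] zero_Cone that by blast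
  qed
  have zero: "0 \<in> F" using stretch[of _ 0] \<open>F \<noteq> {}\<close> by auto
  have scale: "r *\<^sub>R z \<in> F" if "z \<in> F" "0 \<le> r" for r z
  proof -
    have "(1 - r / (r + 2)) *\<^sub>R 0 + (r / (r + 2)) *\<^sub>R ((r + 2) *\<^sub>R z) \<in> F"
      using zero stretch[OF that] that by (intro convexD[OF conv]) auto
    then show ?thesis using that by simp
  qed
  have "u + v \<in> F" if "u \<in> F" "v \<in> F" for u v
  proof -
    have "(1/2) *\<^sub>R u + (1/2) *\<^sub>R v \<in> F" by (intro convexD[OF conv]) (use that in auto)
    from scale[OF this, of 2] show ?thesis by (simp add: algebra_simps)
  qed
  then show ?thesis unfolding convex_cone_iff using zero scale by blast
qed

text \<open>The sum \<open>u + v\<close> is the midpoint of \<open>2 u\<close> and \<open>2 v\<close>. This turns the definition of a face by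
open segments into the usual additive one for cones.\<close>

lemma cone_face_summand:
  assumes "cone_face F (Cone S)" "u \<in> Cone S" "v \<in> Cone S" "u + v \<in> F"
  shows "u \<in> F"
proof -
  have F: "\<And>r z. 0 \<le> r \<Longrightarrow> z \<in> F \<Longrightarrow> r *\<^sub>R z \<in> F"
    using cone_face_convex_cone[OF assms(1)] unfolding convex_cone_iff by blast
  show ?thesis
  proof (cases "u = v")
    case True
    have "(1/2) *\<^sub>R (u + v) \<in> F" using assms by (intro F) auto
    then show ?thesis using True by (simp flip: scaleR_2)
  next
    case False
    have "u + v = (1 - 1/2) *\<^sub>R (2 *\<^sub>R u) + (1/2) *\<^sub>R (2 *\<^sub>R v)" by simp
    moreover have "2 *\<^sub>R u \<noteq> 2 *\<^sub>R v" using False by simp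
    ultimately have "u + v \<in> open_segment (2 *\<^sub>R u) (2 *\<^sub>R v)"
      unfolding in_segment by (intro conjI exI[of _ "1/2"]) simp_all
    moreover have "2 *\<^sub>R u \<in> Cone S" "2 *\<^sub>R v \<in> Cone S"
      using assms by (auto intro: Cone_scale)
    ultimately have "2 *\<^sub>R u \<in> F"
      using assms unfolding cone_face_def by (blast dest: face_ofD)
    from F[OF _ this, of "1/2"] show ?thesis by simp
  qed
qed

text \<open>In a nonnegative combination that lies in \<open>F\<close>, each term with a positive coefficient is a
summand and so lies in \<open>F\<close>.\<close>

lemma cone_face_eq_Cone:
  assumes face: "cone_face F (Cone S)"
  shows "F = Cone (S \<inter> F)"
proof
  show "Cone (S \<inter> F) \<subseteq> F"
    using cone_face_convex_cone[OF face] by (intro Cone_minimal) auto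
  show "F \<subseteq> Cone (S \<inter> F)"
  proof
    fix z assume z: "z \<in> F"
    moreover have "F \<subseteq> Cone S"
      using face unfolding cone_face_def by (auto dest: face_of_imp_subset)
    ultimately have "z \<in> Cone S" by blast
    then obtain G c where G: "finite G" "G \<subseteq> S" "\<forall>s\<in>G. 0 \<le> c s"
      and zG: "z = (\<Sum>s\<in>G. c s *\<^sub>R s)"
      unfolding Cone_def by blast
    define H where "H = {s\<in>G. 0 < c s}"
    have "s \<in> F" if "s \<in> H" for s
    proof -
      have "z = c s *\<^sub>R s + (\<Sum>a\<in>G - {s}. c a *\<^sub>R a)"
        unfolding zG using sum.remove[OF G(1), of s "\<lambda>a. c a *\<^sub>R a"] that by (simp add: H_def)
      moreover have "(\<Sum>a\<in>G - {s}. c a *\<^sub>R a) \<in> Cone S"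
        unfolding Cone_def using G
        by (intro CollectI exI[of _ "G - {s}"] exI[of _ c]) auto
      moreover have "c s *\<^sub>R s \<in> Cone S"
        using Cone_superset[of S] that G unfolding H_def by (intro Cone_scale) auto
      ultimately have "c s *\<^sub>R s \<in> F" using cone_face_summand[OF face] z by metis
      then have "(1 / c s) *\<^sub>R (c s *\<^sub>R s) \<in> F"
        using cone_face_convex_cone[OF face] that unfolding convex_cone_iff H_def
        by (blast intro: less_imp_le divide_nonneg_nonneg zero_le_one)
      then show ?thesis using that unfolding H_def by simp
    qed
    then have "H \<subseteq> S \<inter> F" using G unfolding H_def by auto
    moreover have "z = (\<Sum>s\<in>H. c s *\<^sub>R s)"
      unfolding zG by (rule sum.mono_neutral_right) (use G in \<open>auto simp: H_def less_le\<close>)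
    moreover have "finite H" "\<forall>s\<in>H. 0 \<le> c s" using G unfolding H_def by auto
    ultimately show "z \<in> Cone (S \<inter> F)" unfolding Cone_def by blast
  qed
qed

text \<open>The coordinates outside \<open>S\<close> are nonnegative on the cone; if their weighted mean vanishes, they
all vanish.\<close>

lemma cone_face_Cone_subset:
  fixes B :: "'a::euclidean_space set"
  assumes B: "independent B" and "S \<subseteq> B"
  shows "cone_face (Cone S) (Cone B)"
  unfolding cone_face_def face_of_def
proof (intro conjI ballI impI)
  note mem = mem_Cone_iff_coordinates[OF B assms(2)] mem_Cone_iff_coordinates[OF B order_refl]
  show "Cone S \<subseteq> Cone B" using assms by (rule_tac Cone_mono)
  show "convex (Cone S)" using convex_cone_Cone[of S] unfolding convex_cone_def by blast
  show "Cone S \<noteq> {}" using convex_cone_Cone[of S] unfolding convex_cone_def by blast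
  fix a b z assume a: "a \<in> Cone B" and b: "b \<in> Cone B" and z: "z \<in> Cone S"
    and "z \<in> open_segment a b"
  then obtain u where u: "0 < u" "u < 1" "z = (1 - u) *\<^sub>R a + u *\<^sub>R b"
    unfolding in_segment by blast
  have "representation B a s = 0 \<and> representation B b s = 0" if s: "s \<in> B - S" for s
  proof -
    have "representation B z s = (1 - u) * representation B a s + u * representation B b s"
      using B a b unfolding mem u(3)
      by (simp add: representation_add representation_scale span_mul)
    moreover have "representation B z s = 0" using z s unfolding mem by blast
    moreover have "0 \<le> representation B a s" "0 \<le> representation B b s"
      using a b s unfolding mem by auto
    ultimately show ?thesis using u by (simp add: add_nonneg_eq_0_iff)
  qed
  then show "a \<in> Cone S" "b \<in> Cone S" using a b unfolding mem by auto
qed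

lemma rel_interior_not_in_proper_subcone:
  fixes B :: "'a::euclidean_space set"
  assumes B: "independent B" and "x \<in> rel_interior (Cone B)" "S \<subseteq> B" "x \<in> Cone S"
  shows "S = B"
proof -
  have "Cone S face_of Cone B"
    using cone_face_Cone_subset[OF B assms(3)] unfolding cone_face_def by blast
  then have "Cone S = Cone B" using face_of_disjoint_rel_interior assms by blast
  then have "B \<subseteq> Cone S" using Cone_superset by blast
  then show ?thesis using mem_Cone_independent[OF B assms(3)] assms(3) by blast
qed

section \<open>Simplicial fans as simplicial complexes\<close>

text \<open>A ray has one primitive vector only, so a set of primitive vectors spanning the ray of \<open>g\<close>
cannot avoid \<open>g\<close>.\<close>

lemma primitive_mem_of_Cone_eq_ray:
  fixes N :: "'a::euclidean_space set"
  assumes "full_lattice N" "primitive_in N g" "\<And>r. r \<in> R \<Longrightarrow> primitive_in N r" "Cone {g} = Cone R"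
  shows "g \<in> R"
proof -
  have "g \<in> Cone R" "g \<noteq> 0"
    using Cone_superset[of "{g}"] assms unfolding primitive_in_def by auto
  then obtain r where r: "r \<in> R" using Cone_empty by fastforce
  then have "r \<in> Cone {g}" using Cone_superset[of R] assms(4) by blast
  then obtain t where "0 \<le> t" "r = t *\<^sub>R g" unfolding Cone_singleton_iff by blast
  then have "r = g" using primitive_on_ray_unique assms(1-3) r by blast
  then show ?thesis using r by simp
qed

locale simplicial_lattice_fan =
  fixes N :: "'a::euclidean_space set" and \<Sigma> :: "'a set set"
  assumes lattice: "full_lattice N" and fan: "finite_fan N \<Sigma>" and simplicial: "simplicial_fan \<Sigma>"
begin

abbreviation G where "G \<equiv> fan_gens N \<Sigma>"

definition gen_complex :: "'a set set" where
  "gen_complex = {S. S \<subseteq> G \<and> Cone S \<in> \<Sigma>}"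

lemma face_in_fan: "\<tau> \<in> \<Sigma> \<Longrightarrow> cone_face \<rho> \<tau> \<Longrightarrow> \<rho> \<in> \<Sigma>"
  using fan unfolding finite_fan_def by blast

lemma Int_face: "\<rho> \<in> \<Sigma> \<Longrightarrow> \<tau> \<in> \<Sigma> \<Longrightarrow> cone_face (\<rho> \<inter> \<tau>) \<tau>"
  using fan unfolding finite_fan_def by blast

lemma gens_primitive: "g \<in> G \<Longrightarrow> primitive_in N g"
  unfolding fan_gens_def by blast

lemma gens_ray: "g \<in> G \<Longrightarrow> Cone {g} \<in> \<Sigma>"
  unfolding fan_gens_def by blast

lemma gens_nonzero: "g \<in> G \<Longrightarrow> g \<noteq> 0"
  using gens_primitive unfolding primitive_in_def by blast

text \<open>The basis that spans a cone of a simplicial fan need not consist of lattice vectors.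
Rationality helps: the ray of \<open>b\<close> is a face, hence spanned by those lattice generators of the
cone that lie on it, and there must be a nonzero one among them.\<close>

lemma ray_of_cone_has_generator:
  assumes "Cone B \<in> \<Sigma>" "independent B" "b \<in> B"
  shows "\<exists>r>0. r *\<^sub>R b \<in> G"
proof -
  obtain S where S: "S \<subseteq> N" "Cone B = Cone S"
    using fan assms(1) unfolding finite_fan_def rational_cone_def by blast
  have face: "cone_face (Cone {b}) (Cone B)"
    using assms by (intro cone_face_Cone_subset) auto
  have b0: "b \<noteq> 0" using assms dependent_zero by blast
  have "Cone {b} = Cone (S \<inter> Cone {b})"
    using face cone_face_eq_Cone unfolding S(2) by blast
  moreover have "Cone (S \<inter> Cone {b}) \<subseteq> {0}" if "S \<inter> Cone {b} \<subseteq> {0}"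
    using that by (intro Cone_minimal) (auto simp: convex_cone_iff)
  moreover have "b \<in> Cone {b}" using Cone_superset[of "{b}"] by blast
  ultimately obtain s where s: "s \<in> S" "s \<in> Cone {b}" "s \<noteq> 0" using b0 by blast
  obtain t where t: "0 \<le> t" "s = t *\<^sub>R b" using s(2) unfolding Cone_singleton_iff by blast
  have tpos: "0 < t" using t s(3) by (cases "t = 0") auto
  have "s \<in> N" using s S by blast
  then obtain v and k :: nat where v: "primitive_in N v" "0 < k" "s = of_nat k *\<^sub>R v"
    using primitive_on_ray_exists[OF lattice _ s(3)] by metis
  have vb: "v = (t / k) *\<^sub>R b"
  proof -
    have "v = (1 / real k) *\<^sub>R s" using v(2,3) by simp
    then show ?thesis using t(2) by simp
  qed
  have pos: "0 < t / k" using tpos v(2) by simp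
  have "Cone {v} = Cone {b}"
  proof
    show "Cone {v} \<subseteq> Cone {b}"
      using vb less_imp_le[OF pos]
      by (intro Cone_minimal convex_cone_Cone) (simp add: Cone_singleton_iff, blast)
    have "b = (k / t) *\<^sub>R v" using vb tpos v(2) by simp
    moreover have "0 \<le> k / t" using tpos by simp
    ultimately show "Cone {b} \<subseteq> Cone {v}"
      by (intro Cone_minimal convex_cone_Cone) (auto simp: Cone_singleton_iff)
  qed
  moreover have "Cone {b} \<in> \<Sigma>" using face_in_fan assms(1) face by blast
  moreover have "dim (Cone {v}) = 1"
    using v(1) unfolding dim_Cone primitive_in_def by (simp add: dim_singleton)
  ultimately have "v \<in> G" using v(1) unfolding fan_gens_def by auto
  then show ?thesis using vb pos by blast
qed

lemma cone_spanned_by_generators: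
  assumes "\<tau> \<in> \<Sigma>"
  obtains B where "independent B" "B \<subseteq> G" "\<tau> = Cone B"
proof -
  obtain C where C: "independent C" "\<tau> = Cone C"
    using assms simplicial unfolding simplicial_fan_def by blast
  then have "\<forall>b\<in>C. \<exists>r>0. r *\<^sub>R b \<in> G" using ray_of_cone_has_generator assms by blast
  then obtain r where r: "\<And>b. b \<in> C \<Longrightarrow> 0 < r b \<and> r b *\<^sub>R b \<in> G" by metis
  define B where "B = (\<lambda>b. r b *\<^sub>R b) ` C"
  have "Cone B = Cone C"
  proof
    show "Cone B \<subseteq> Cone C"
      unfolding B_def using r Cone_superset[of C]
      by (intro Cone_minimal convex_cone_Cone) (blast intro: Cone_scale less_imp_le)
    have "b \<in> Cone B" if "b \<in> C" for b
    proof -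
      have "r b *\<^sub>R b \<in> Cone B" using that Cone_superset[of B] unfolding B_def by blast
      moreover have "0 \<le> 1 / r b" using r[OF that] by simp
      ultimately have "(1 / r b) *\<^sub>R (r b *\<^sub>R b) \<in> Cone B"
        by (intro Cone_scale[of "1 / r b"])
      then show ?thesis using r[OF that] by simp
    qed
    then show "Cone C \<subseteq> Cone B" by (intro Cone_minimal convex_cone_Cone) blast
  qed
  moreover have "independent B"
  proof -
    have fin: "finite C" using C(1) by (rule independent_imp_finite)
    have "card B \<le> card C" unfolding B_def using fin by (rule card_image_le)
    also have "card C = dim B"
      using dim_eq_card_independent[OF C(1)] \<open>Cone B = Cone C\<close> by (metis dim_Cone)
    finally show ?thesis
      using fin by (intro card_le_dim_spanning[of B B]) (auto simp: B_def span_base)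
  qed
  moreover have "B \<subseteq> G" unfolding B_def using r by auto
  ultimately show thesis using that C by simp
qed

text \<open>The ray of a generator \<open>g\<close> in the cone meets the cone in a face. That face is spanned by a
part of \<open>B\<close>, which must then contain \<open>g\<close>.\<close>

lemma cone_gens_Cone_independent:
  assumes "independent B" "B \<subseteq> G" "Cone B \<in> \<Sigma>"
  shows "cone_gens N \<Sigma> (Cone B) = B"
proof
  show "B \<subseteq> cone_gens N \<Sigma> (Cone B)"
    using assms Cone_superset unfolding cone_gens_def by blast
  show "cone_gens N \<Sigma> (Cone B) \<subseteq> B"
  proof
    fix g assume "g \<in> cone_gens N \<Sigma> (Cone B)"
    then have g: "g \<in> G" "g \<in> Cone B" unfolding cone_gens_def by auto
    then have "Cone {g} \<inter> Cone B = Cone {g}"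
      using Cone_minimal[OF _ convex_cone_Cone, of "{g}" B] by blast
    then have "cone_face (Cone {g}) (Cone B)"
      using Int_face[OF gens_ray[OF g(1)] assms(3)] by simp
    then have "Cone {g} = Cone (B \<inter> Cone {g})" by (rule cone_face_eq_Cone)
    then have "g \<in> B \<inter> Cone {g}"
      using assms(2) gens_primitive g(1) by (intro primitive_mem_of_Cone_eq_ray[OF lattice]) auto
    then show "g \<in> B" by blast
  qed
qed

lemma
  assumes "\<tau> \<in> \<Sigma>"
  shows independent_cone_gens: "independent (cone_gens N \<Sigma> \<tau>)"
    and Cone_cone_gens: "Cone (cone_gens N \<Sigma> \<tau>) = \<tau>"
    and cone_gens_in_complex: "cone_gens N \<Sigma> \<tau> \<in> gen_complex"
proof -
  obtain B where B: "independent B" "B \<subseteq> G" "\<tau> = Cone B"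
    using cone_spanned_by_generators[OF assms] .
  then have "cone_gens N \<Sigma> \<tau> = B" using cone_gens_Cone_independent assms by simp
  then show "independent (cone_gens N \<Sigma> \<tau>)" "Cone (cone_gens N \<Sigma> \<tau>) = \<tau>"
    "cone_gens N \<Sigma> \<tau> \<in> gen_complex" using B assms unfolding gen_complex_def by auto
qed

lemma complex_independent:
  assumes "S \<in> gen_complex" shows "independent S"
proof -
  have "S \<subseteq> cone_gens N \<Sigma> (Cone S)"
    using assms Cone_superset unfolding gen_complex_def cone_gens_def by blast
  then show ?thesis
    using independent_cone_gens assms independent_mono unfolding gen_complex_def by blast
qed

lemma complex_finite: "S \<in> gen_complex \<Longrightarrow> finite S"
  using complex_independent independent_imp_finite by blast

lemma complex_cone_gens: "S \<in> gen_complex \<Longrightarrow> cone_gens N \<Sigma> (Cone S) = S"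
  using cone_gens_Cone_independent complex_independent unfolding gen_complex_def by blast

lemma complex_mem_Cone: "S \<in> gen_complex \<Longrightarrow> g \<in> G \<Longrightarrow> g \<in> Cone S \<Longrightarrow> g \<in> S"
  using complex_cone_gens unfolding cone_gens_def by blast

lemma complex_subset:
  assumes "S \<in> gen_complex" "T \<subseteq> S" shows "T \<in> gen_complex"
proof -
  have "cone_face (Cone T) (Cone S)"
    by (rule cone_face_Cone_subset[OF complex_independent[OF assms(1)] assms(2)])
  then show ?thesis using face_in_fan assms unfolding gen_complex_def by blast
qed

end

section \<open>Minimal nonfaces of a stellar subdivision\<close>

definition minimal_nonfaces :: "'a set \<Rightarrow> 'a set set \<Rightarrow> 'a set set" where
  "minimal_nonfaces V K = {P. P \<noteq> {} \<and> P \<subseteq> V \<and> P \<notin> K \<and> (\<forall>y\<in>P. P - {y} \<in> K)}"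

definition stellar :: "'a \<Rightarrow> 'a set \<Rightarrow> 'a set set \<Rightarrow> 'a set set" where
  "stellar x A K = {S \<in> K. \<not> A \<subseteq> S} \<union> {insert x S | S. \<not> A \<subseteq> S \<and> S \<union> A \<in> K}"

lemma stellar_newI: "\<not> A \<subseteq> S \<Longrightarrow> S \<union> A \<in> K \<Longrightarrow> insert x S \<in> stellar x A K"
  unfolding stellar_def by blast

lemma stellar_cases:
  assumes "Q \<in> stellar x A K"
  obtains (old) "Q \<in> K" "\<not> A \<subseteq> Q" | (new) S where "Q = insert x S" "\<not> A \<subseteq> S" "S \<union> A \<in> K"
  using assms unfolding stellar_def by blast

locale stellar_subdivision =
  fixes V :: "'a set" and K :: "'a set set" and A :: "'a set" and x :: 'a
  assumes vertices: "S \<in> K \<Longrightarrow> S \<subseteq> V"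
    and finite_face: "S \<in> K \<Longrightarrow> finite S"
    and face_subset: "S \<in> K \<Longrightarrow> T \<subseteq> S \<Longrightarrow> T \<in> K"
    and A_face: "A \<in> K" and A_nonempty: "A \<noteq> {}"
    and x_new: "x \<notin> V"
begin

lemma nonface_contains_minimal:
  assumes "finite S" "S \<subseteq> V" "S \<notin> K"
  obtains P where "P \<in> minimal_nonfaces V K" "P \<subseteq> S"
proof -
  define Z where "Z = {P. P \<subseteq> S \<and> P \<notin> K}"
  have "finite Z" "S \<in> Z" using assms unfolding Z_def by auto
  then obtain P where P: "P \<in> Z" "\<And>Q. Q \<in> Z \<Longrightarrow> Q \<subseteq> P \<Longrightarrow> P = Q"
    using finite_has_minimal[of Z] by auto
  have PS: "P \<subseteq> S" "P \<notin> K" using P(1) unfolding Z_def by auto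
  have "P \<noteq> {}" using face_subset[OF A_face, of "{}"] PS(2) by auto
  moreover have "P - {y} \<in> K" if "y \<in> P" for y using P(2)[of "P - {y}"] PS(1) that unfolding Z_def by blast
  ultimately have "P \<in> minimal_nonfaces V K"
    unfolding minimal_nonfaces_def using PS assms(2) by blast
  then show thesis using that PS(1) by blast
qed

lemma nonface_if_contains_minimal:
  "P \<in> minimal_nonfaces V K \<Longrightarrow> P \<subseteq> S \<Longrightarrow> S \<notin> K"
  unfolding minimal_nonfaces_def using face_subset by blast

text \<open>No face of \<open>K\<close> contains \<open>x\<close>, so the two kinds of faces of the subdivision are told apart by
whether they contain \<open>x\<close>.\<close>

lemma mem_stellar_old: "x \<notin> S \<Longrightarrow> S \<in> stellar x A K \<longleftrightarrow> S \<in> K \<and> \<not> A \<subseteq> S"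
  unfolding stellar_def by auto

lemma mem_stellar_new:
  assumes "x \<notin> S"
  shows "insert x S \<in> stellar x A K \<longleftrightarrow> \<not> A \<subseteq> S \<and> S \<union> A \<in> K"
proof
  assume "insert x S \<in> stellar x A K"
  moreover have "insert x S \<notin> K" using vertices x_new by blast
  ultimately obtain T where T: "insert x S = insert x T" "\<not> A \<subseteq> T" "T \<union> A \<in> K"
    unfolding stellar_def by blast
  moreover have "x \<notin> T" using T(3) vertices x_new by blast
  ultimately have "S = T" using assms insert_ident by metis
  then show "\<not> A \<subseteq> S \<and> S \<union> A \<in> K" using T by blast
qed (auto simp: stellar_def)

lemma stellar_subset:
  assumes "S \<in> stellar x A K" "T \<subseteq> S" shows "T \<in> stellar x A K"
  using assms(1)
proof (cases rule: stellar_cases)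
  case old
  then show ?thesis using assms face_subset unfolding stellar_def by blast
next
  case R: (new R)
  have T: "\<not> A \<subseteq> T - {x}" "(T - {x}) \<union> A \<in> K"
    using R assms(2) face_subset[OF R(3), of "T - {x} \<union> A"] by blast+
  show ?thesis
  proof (cases "x \<in> T")
    case True
    then have "T = insert x (T - {x})" by blast
    then show ?thesis using stellar_newI T by metis
  next
    case False
    then have "T = T - {x}" by blast
    then have "T \<in> K" "\<not> A \<subseteq> T" using T face_subset[OF T(2)] by auto
    then show ?thesis unfolding stellar_def by blast
  qed
qed

abbreviation new_nonfaces :: "'a set set" where
  "new_nonfaces \<equiv> {(P - A) \<union> {x} | P. P \<in> minimal_nonfaces V K \<and> P \<inter> A \<noteq> {}}"

lemma minimal_nonface_old_iff:
  assumes "x \<notin> P"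
  shows "P \<in> minimal_nonfaces (insert x V) (stellar x A K)
    \<longleftrightarrow> P = A \<or> P \<in> minimal_nonfaces V K \<and> \<not> A \<subseteq> P" (is "?l \<longleftrightarrow> ?r")
proof -
  have l: "?l \<longleftrightarrow> P \<noteq> {} \<and> P \<subseteq> V \<and> \<not> (P \<in> K \<and> \<not> A \<subseteq> P)
      \<and> (\<forall>y\<in>P. P - {y} \<in> K \<and> \<not> A \<subseteq> P - {y})"
    using assms unfolding minimal_nonfaces_def by (auto simp: mem_stellar_old)
  show ?thesis
  proof
    assume L: ?l
    show ?r
    proof (cases "A \<subseteq> P")
      case True
      then have "P = A" using L unfolding l by blast
      then show ?thesis by blast
    next
      case False
      then have "P \<in> minimal_nonfaces V K" using L[unfolded l] unfolding minimal_nonfaces_def by simp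
      then show ?thesis using False by blast
    qed
  next
    assume ?r
    then show ?l
    proof
      assume "P = A"
      moreover have "A - {y} \<in> K \<and> \<not> A \<subseteq> A - {y}" if "y \<in> A" for y
        using that face_subset[OF A_face, of "A - {y}"] by blast
      ultimately show ?l unfolding l using A_nonempty vertices[OF A_face] by simp
    next
      assume P: "P \<in> minimal_nonfaces V K \<and> \<not> A \<subseteq> P"
      then have "\<not> A \<subseteq> P - {y}" for y by blast
      then show ?l unfolding l using P unfolding minimal_nonfaces_def by simp
    qed
  qed
qed

text \<open>Write the set as \<open>S \<union> {x}\<close>. If \<open>S \<in> K\<close> does not contain \<open>A\<close>, then \<open>S \<union> {x}\<close> is a nonface iff
\<open>S \<union> A \<notin> K\<close>, iff \<open>Q - A \<subseteq> S\<close> for some minimal nonface \<open>Q\<close> of \<open>K\<close>, and such a \<open>Q\<close> meets \<open>A\<close>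
because \<open>S\<close> is a face. So \<open>S\<close> is minimal with this property iff it is a minimal set
\<open>Q - A\<close>.\<close>

lemma minimal_nonface_new_iff:
  assumes x: "x \<in> P"
  shows "P \<in> minimal_nonfaces (insert x V) (stellar x A K) \<longleftrightarrow> P \<in> minimal_sets new_nonfaces"
proof
  assume P: "P \<in> minimal_nonfaces (insert x V) (stellar x A K)"
  define S where "S = P - {x}"
  have PS: "P = insert x S" "x \<notin> S" using x unfolding S_def by auto
  have "S \<in> stellar x A K" using P x unfolding minimal_nonfaces_def S_def by blast
  then have S: "S \<in> K" "\<not> A \<subseteq> S" using PS(2) by (auto simp: mem_stellar_old)
  have "P \<notin> stellar x A K" using P unfolding minimal_nonfaces_def by blast
  then have SA: "S \<union> A \<notin> K" using S PS mem_stellar_new by blast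
  have below: "(S - {y}) \<union> A \<in> K" if "y \<in> S" for y
  proof -
    have "P - {y} \<in> stellar x A K" using P that PS unfolding minimal_nonfaces_def by blast
    moreover have "P - {y} = insert x (S - {y})" using PS that by blast
    ultimately show ?thesis using mem_stellar_new[of "S - {y}"] PS(2) by auto
  qed
  \<comment> \<open>If \<open>Q - A\<close> is not all of \<open>S\<close>, the nonface \<open>Q\<close> lies in the face \<open>(S - {y}) \<union> A\<close> for
    some \<open>y \<in> S\<close>.\<close>
  have trace: "Q - A = S" if Q: "Q \<in> minimal_nonfaces V K" "Q - A \<subseteq> S" for Q
  proof (rule ccontr)
    assume "Q - A \<noteq> S"
    then obtain y where y: "y \<in> S" "y \<notin> Q - A" using Q(2) by blast
    then have "Q \<subseteq> (S - {y}) \<union> A" using Q(2) by blast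
    then show False using nonface_if_contains_minimal[OF Q(1)] below[OF y(1)] by blast
  qed
  have fin: "finite (S \<union> A)" "S \<union> A \<subseteq> V"
    using S(1) A_face finite_face vertices by auto
  obtain Q where Q: "Q \<in> minimal_nonfaces V K" "Q \<subseteq> S \<union> A"
    using nonface_contains_minimal[OF fin SA] .
  have "Q \<inter> A \<noteq> {}" using nonface_if_contains_minimal[OF Q(1), of S] Q(2) S(1) by blast
  moreover have QS: "Q - A = S" using trace Q by blast
  ultimately have "P \<in> new_nonfaces" using Q(1) PS by blast
  moreover have "T = P" if T: "T \<in> new_nonfaces" "T \<subseteq> P" for T
  proof -
    obtain R where R: "R \<in> minimal_nonfaces V K" "T = (R - A) \<union> {x}" using T(1) by blast
    have "R \<subseteq> V" using R(1) unfolding minimal_nonfaces_def by blast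
    then have "R - A \<subseteq> S" using R(2) T(2) PS(1) x_new by blast
    then show ?thesis using trace R PS(1) by blast
  qed
  ultimately show "P \<in> minimal_sets new_nonfaces" unfolding minimal_sets_def by blast
next
  assume P: "P \<in> minimal_sets new_nonfaces"
  then obtain Q where Q: "Q \<in> minimal_nonfaces V K" "Q \<inter> A \<noteq> {}" "P = (Q - A) \<union> {x}"
    unfolding minimal_sets_def by blast
  define S where "S = Q - A"
  have QV: "Q \<subseteq> V" using Q(1) unfolding minimal_nonfaces_def by blast
  have PS: "P = insert x S" "x \<notin> S" using Q(3) QV x_new unfolding S_def by auto
  have nA: "\<not> A \<subseteq> S - T" for T using A_nonempty unfolding S_def by blast
  have SK: "S \<in> K"
  proof -
    obtain a where a: "a \<in> Q" "a \<in> A" using Q(2) by blast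
    then have "Q - {a} \<in> K" using Q(1) unfolding minimal_nonfaces_def by blast
    then show ?thesis using face_subset a(2) unfolding S_def by blast
  qed
  have "S \<union> A \<notin> K"
    using nonface_if_contains_minimal[OF Q(1), of "S \<union> A"] unfolding S_def by blast
  then have "P \<notin> stellar x A K" using mem_stellar_new PS by blast
  moreover have "P - {y} \<in> stellar x A K" if "y \<in> P" for y
  proof (cases "y = x")
    case True
    then have "P - {y} = S" using PS by blast
    then show ?thesis using SK nA[of "{}"] PS(2) by (simp add: mem_stellar_old)
  next
    case False
    then have y: "y \<in> S" "P - {y} = insert x (S - {y})" using that PS by auto
    have "(S - {y}) \<union> A \<in> K"
    proof (rule ccontr)
      assume non: "(S - {y}) \<union> A \<notin> K"
      have fin: "finite ((S - {y}) \<union> A)" "(S - {y}) \<union> A \<subseteq> V"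
        using SK A_face finite_face vertices by auto
      obtain R where R: "R \<in> minimal_nonfaces V K" "R \<subseteq> (S - {y}) \<union> A"
        using nonface_contains_minimal[OF fin non] .
      have "R \<inter> A \<noteq> {}" using nonface_if_contains_minimal[OF R(1), of S] R(2) SK by blast
      then have "(R - A) \<union> {x} \<in> new_nonfaces" using R(1) by blast
      moreover have "(R - A) \<union> {x} \<subseteq> P" using R(2) PS(1) by blast
      ultimately have "(R - A) \<union> {x} = P" using P unfolding minimal_sets_def by blast
      then show False using R(2) y(1) PS unfolding S_def by blast
    qed
    then show ?thesis using mem_stellar_new[of "S - {y}"] nA PS(2) y(2) by auto
  qed
  moreover have "P \<subseteq> insert x V" "P \<noteq> {}" using PS QV unfolding S_def by auto
  ultimately show "P \<in> minimal_nonfaces (insert x V) (stellar x A K)"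
    unfolding minimal_nonfaces_def by blast
qed

lemma minimal_nonfaces_stellar:
  "minimal_nonfaces (insert x V) (stellar x A K) =
     {A} \<union> {P \<in> minimal_nonfaces V K. \<not> A \<subseteq> P} \<union> minimal_sets new_nonfaces" (is "?l = ?r")
proof (rule set_eqI)
  fix P
  show "P \<in> ?l \<longleftrightarrow> P \<in> ?r"
  proof (cases "x \<in> P")
    case True
    have "P \<noteq> A" "P \<notin> minimal_nonfaces V K"
      using True x_new vertices[OF A_face] unfolding minimal_nonfaces_def by auto
    then show ?thesis using minimal_nonface_new_iff[OF True] by simp
  next
    case False
    then have "P \<notin> minimal_sets new_nonfaces" unfolding minimal_sets_def by blast
    then show ?thesis using minimal_nonface_old_iff[OF False] by simp
  qed
qed

end

section \<open>The star subdivision of a fan\<close>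

lemma (in simplicial_lattice_fan) PC_eq_minimal_nonfaces: "PC N \<Sigma> = minimal_nonfaces G gen_complex"
  unfolding PC_def minimal_nonfaces_def gen_complex_def by blast

locale fan_star_subdivision = simplicial_lattice_fan +
  fixes \<sigma> :: "'a set" and x :: 'a
  assumes cone: "\<sigma> \<in> \<Sigma>" and dim_cone: "2 \<le> dim \<sigma>"
    and x_primitive: "primitive_in N x" and x_interior: "x \<in> rel_interior \<sigma>"
begin

abbreviation A where "A \<equiv> cone_gens N \<Sigma> \<sigma>"
abbreviation star where "star \<equiv> star_subdivision N \<Sigma> \<sigma> x"

lemmas A_independent = independent_cone_gens[OF cone]
lemmas Cone_A = Cone_cone_gens[OF cone]
lemmas A_complex = cone_gens_in_complex[OF cone]

lemma A_subset: "A \<subseteq> G" unfolding cone_gens_def by blast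

lemma x_mem: "x \<in> Cone A"
  using x_interior rel_interior_subset unfolding Cone_A by blast

lemma A_two: "\<not> A \<subseteq> {a}"
proof
  assume "A \<subseteq> {a}"
  then have "dim A \<le> dim {a}" by (rule dim_subset)
  then have "dim A \<le> 1" using dim_le_card'[of "{a}"] by simp
  then show False using dim_cone Cone_A dim_Cone[of A] by simp
qed

text \<open>A cone containing \<open>x\<close> meets \<open>\<sigma>\<close> in a face through a point of the relative interior, that is,
in all of \<open>\<sigma>\<close>.\<close>

lemma carrier_of_x:
  assumes "S \<in> gen_complex" "x \<in> Cone S" shows "A \<subseteq> S"
proof -
  have S: "Cone S \<in> \<Sigma>" using assms unfolding gen_complex_def by blast
  have "cone_face (Cone S \<inter> \<sigma>) (Cone A)" using Int_face[OF S cone] Cone_A by simp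
  then have "Cone S \<inter> \<sigma> = Cone (A \<inter> (Cone S \<inter> \<sigma>))" by (rule cone_face_eq_Cone)
  then have "x \<in> Cone (A \<inter> (Cone S \<inter> \<sigma>))" using assms x_mem Cone_A by blast
  then have "A \<inter> (Cone S \<inter> \<sigma>) = A"
    using rel_interior_not_in_proper_subcone[OF A_independent] x_interior Cone_A by simp
  then show ?thesis using complex_mem_Cone assms(1) A_subset by blast
qed

lemma x_new: "x \<notin> G"
proof
  assume "x \<in> G"
  then have "{x} \<in> gen_complex" using gens_ray unfolding gen_complex_def by simp
  then have "A \<subseteq> {x}" using Cone_superset[of "{x}"] by (intro carrier_of_x) auto
  then show False using A_two by blast
qed

sublocale stellar_subdivision G gen_complex A x
proof
  show "S \<subseteq> G" if "S \<in> gen_complex" for S using that unfolding gen_complex_def by blast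
  show "A \<noteq> {}" using A_two by blast
qed (fact complex_finite complex_subset A_complex x_new)+

lemma x_coordinate_pos:
  assumes B: "S \<union> A \<in> gen_complex" and y: "y \<in> A"
  shows "0 < representation (S \<union> A) x y"
proof -
  have ind: "independent (S \<union> A)" using B by (rule complex_independent)
  have mem: "x \<in> span (S \<union> A)" "\<forall>b\<in>S \<union> A. 0 \<le> representation (S \<union> A) x b"
    "\<forall>b\<in>(S \<union> A) - A. representation (S \<union> A) x b = 0"
    using x_mem mem_Cone_iff_coordinates[OF ind, of A x] by auto
  have "representation (S \<union> A) x y \<noteq> 0"
  proof
    assume "representation (S \<union> A) x y = 0"
    then have "x \<in> Cone (A - {y})"
      using mem mem_Cone_iff_coordinates[OF ind, of "A - {y}" x] by blast
    then have "A - {y} = A"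
      using rel_interior_not_in_proper_subcone[OF A_independent] x_interior Cone_A by simp
    then show False using y by blast
  qed
  then show ?thesis using mem(2) y by (simp add: less_le)
qed

text \<open>Some \<open>y \<in> A\<close> is missing from \<open>S\<close>; vectors in the span of \<open>S\<close> have coordinate zero at \<open>y\<close>,
but \<open>x\<close> does not.\<close>

lemma new_cone_independent:
  assumes "\<not> A \<subseteq> S" "S \<union> A \<in> gen_complex"
  shows "independent (insert x S)"
proof -
  obtain y where y: "y \<in> A" "y \<notin> S" using assms(1) by blast
  have ind: "independent (S \<union> A)" using assms(2) by (rule complex_independent)
  have "x \<notin> span S"
  proof
    assume "x \<in> span S"
    then have "representation (S \<union> A) x = representation S x"
      using ind by (intro representation_extend) auto
    then have "representation S x y \<noteq> 0" using x_coordinate_pos[OF assms(2) y(1)] by simp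
    then show False using y(2) representation_ne_zero by blast
  qed
  moreover have "independent S" using ind independent_mono by blast
  ultimately show ?thesis by (simp add: independent_insertI)
qed

text \<open>Write \<open>g = t x + u\<close> with \<open>u\<close> in \<open>Cone S\<close>. For \<open>t > 0\<close> all coordinates of \<open>g\<close> at \<open>A\<close> would be
positive. But \<open>g\<close> is itself an element of the basis \<open>S \<union> A\<close>, with one nonzero coordinate, and
\<open>A\<close> has at least two elements.\<close>

lemma new_cone_generators:
  assumes "\<not> A \<subseteq> S" "S \<union> A \<in> gen_complex" "g \<in> G" "g \<in> Cone (insert x S)"
  shows "g \<in> S"
proof -
  let ?B = "S \<union> A"
  have ind: "independent ?B" using assms(2) by (rule complex_independent)
  have "g \<in> Cone {x} + Cone S" using assms(4) by (simp flip: Cone_Un)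
  then obtain w u where w: "w \<in> Cone {x}" and u: "u \<in> Cone S" and "g = w + u"
    by (rule set_plus_elim)
  then obtain t where t: "0 \<le> t" and g: "g = t *\<^sub>R x + u"
    unfolding Cone_singleton_iff by blast
  have xB: "x \<in> Cone ?B" using x_mem Cone_mono[of A ?B] by blast
  have uB: "u \<in> Cone ?B" using u Cone_mono[of S ?B] by blast
  have "g \<in> Cone ?B" unfolding g using xB uB t by (intro Cone_add Cone_scale)
  then have gB: "g \<in> ?B" using complex_mem_Cone assms by blast
  note mem = mem_Cone_iff_coordinates[OF ind order_refl]
  have "t = 0"
  proof (rule ccontr)
    assume "t \<noteq> 0"
    have "y = g" if y: "y \<in> A" for y
    proof (rule ccontr)
      assume "y \<noteq> g"
      have "representation ?B g y = t * representation ?B x y + representation ?B u y"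
        using ind xB uB unfolding g mem
        by (simp add: representation_add representation_scale span_mul)
      moreover have "0 \<le> representation ?B u y" using uB y unfolding mem by blast
      moreover have "0 < t * representation ?B x y"
        using x_coordinate_pos[OF assms(2) y] t \<open>t \<noteq> 0\<close> by simp
      moreover have "representation ?B g y = 0"
        using representation_basis[OF ind gB] \<open>y \<noteq> g\<close> by simp
      ultimately show False by linarith
    qed
    then show False using A_two[of g] by blast
  qed
  then have "g \<in> Cone S" using g u by simp
  then show ?thesis using mem_Cone_independent[OF ind _ gB] by blast
qed

lemma face_sigma_iff:
  assumes "S \<in> gen_complex" shows "cone_face \<sigma> (Cone S) \<longleftrightarrow> A \<subseteq> S"
proof
  assume "cone_face \<sigma> (Cone S)"
  then have "\<sigma> \<subseteq> Cone S" unfolding cone_face_def by (auto dest: face_of_imp_subset)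
  then show "A \<subseteq> S" using carrier_of_x[OF assms] x_mem Cone_A by blast
next
  assume "A \<subseteq> S"
  then show "cone_face \<sigma> (Cone S)"
    using cone_face_Cone_subset[OF complex_independent[OF assms]] Cone_A by metis
qed

text \<open>A face of \<open>\<sigma>\<^sub>i + \<tau>'\<close> is spanned by a part of the set consisting of \<open>x\<close>, the elements
of \<open>A\<close> other than \<open>y = x\<^sub>i\<close>, and the generators of \<open>\<tau>'\<close>. That set does not contain \<open>A\<close>: the
vector \<open>y\<close> is not in \<open>\<tau>'\<close> since \<open>\<sigma>\<close> and \<open>\<tau>'\<close> meet only in \<open>0\<close>, and it is not \<open>x\<close> since \<open>x\<close> is
no generator of \<open>\<Sigma>\<close>.\<close>

lemma star_subset:
  assumes C: "C \<in> star" shows "C \<in> Cone ` stellar x A gen_complex"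
proof (cases "C \<in> \<Sigma> - {\<tau>\<in>\<Sigma>. cone_face \<sigma> \<tau>}")
  case True
  define S where "S = cone_gens N \<Sigma> C"
  have S: "S \<in> gen_complex" "C = Cone S"
    using True cone_gens_in_complex Cone_cone_gens unfolding S_def by auto
  then have "\<not> A \<subseteq> S" using face_sigma_iff True by blast
  then show ?thesis using S unfolding stellar_def by blast
next
  case False
  then obtain \<tau> \<tau>' y where t: "\<tau> \<in> \<Sigma>" "\<tau>' \<in> \<Sigma>" "y \<in> A" "\<tau> = \<sigma> + \<tau>'" "\<sigma> \<inter> \<tau>' = {0}"
    and face: "cone_face C (Cone (insert x (A - {y})) + \<tau>')"
    using C unfolding star_subdivision_def by blast
  define T where "T = cone_gens N \<Sigma> \<tau>'"
  have T: "Cone T = \<tau>'" "T \<subseteq> G"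
    using Cone_cone_gens[OF t(2)] unfolding T_def cone_gens_def by auto
  have AT: "A \<union> T \<in> gen_complex"
    using t(1,4) T A_subset Cone_A unfolding gen_complex_def by (simp add: Cone_Un)
  have "y \<notin> T"
  proof
    assume "y \<in> T"
    then have "y \<in> \<sigma> \<inter> \<tau>'" using t(3) unfolding T_def cone_gens_def by blast
    then have "y = 0" using t(5) by blast
    then show False using gens_nonzero A_subset t(3) by blast
  qed
  have "Cone (insert x (A - {y})) + \<tau>' = Cone (insert x ((A - {y}) \<union> T))"
    unfolding T(1)[symmetric] Cone_Un[symmetric] by simp
  then have "C = Cone (insert x ((A - {y}) \<union> T) \<inter> C)"
    using face cone_face_eq_Cone by metis
  moreover have "insert x ((A - {y}) \<union> T) \<inter> C \<in> stellar x A gen_complex"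
  proof -
    have "\<not> A \<subseteq> (A - {y}) \<union> T" using t(3) \<open>y \<notin> T\<close> by blast
    moreover have "((A - {y}) \<union> T) \<union> A = A \<union> T" using t(3) by blast
    ultimately have "insert x ((A - {y}) \<union> T) \<in> stellar x A gen_complex"
      using AT by (intro stellar_newI) simp_all
    then show ?thesis by (rule stellar_subset) blast
  qed
  ultimately show ?thesis by (rule image_eqI)
qed

text \<open>For a new face \<open>S \<union> {x}\<close> take \<open>\<tau> = Cone (S \<union> A)\<close> and \<open>\<tau>' = Cone (S - A)\<close>, and leave out
some \<open>y \<in> A - S\<close>. By independence, any part of the generators of \<open>\<sigma>\<^sub>i + \<tau>'\<close> spans a
face.\<close>

lemma star_superset:
  assumes "Q \<in> stellar x A gen_complex" shows "Cone Q \<in> star"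
  using assms
proof (cases rule: stellar_cases)
  case old
  have "Cone Q \<in> \<Sigma>" using old(1) unfolding gen_complex_def by blast
  moreover have "\<not> cone_face \<sigma> (Cone Q)" using face_sigma_iff[OF old(1)] old(2) by blast
  ultimately show ?thesis unfolding star_subdivision_def by simp
next
  case S: (new S)
  obtain y where y: "y \<in> A" "y \<notin> S" using S(2) by blast
  define T where "T = S - A"
  have AT: "A \<union> T = S \<union> A" unfolding T_def by blast
  have ind: "independent (S \<union> A)" using S(3) by (rule complex_independent)
  have T: "T \<in> gen_complex" using complex_subset[OF S(3)] unfolding T_def by blast
  have Q': "insert x (A - {y}) \<union> T = insert x ((S \<union> A) - {y})" using y unfolding T_def by blast
  have "independent (insert x ((S \<union> A) - {y}))"
  proof (rule new_cone_independent)
    show "\<not> A \<subseteq> (S \<union> A) - {y}" using y by blast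
    have "((S \<union> A) - {y}) \<union> A = S \<union> A" using y by blast
    then show "((S \<union> A) - {y}) \<union> A \<in> gen_complex" using S(3) by simp
  qed
  moreover have "Q \<subseteq> insert x ((S \<union> A) - {y})" using S(1) y by blast
  ultimately have "cone_face (Cone Q) (Cone (insert x ((S \<union> A) - {y})))"
    by (rule cone_face_Cone_subset)
  then have "cone_face (Cone Q) (Cone (insert x (A - {y})) + Cone T)"
    unfolding Q'[symmetric] Cone_Un .
  moreover have "Cone (S \<union> A) \<in> \<Sigma>" "Cone T \<in> \<Sigma>" using S(3) T unfolding gen_complex_def by auto
  moreover have "cone_face \<sigma> (Cone (S \<union> A))" using face_sigma_iff[OF S(3)] by blast
  moreover have "Cone (S \<union> A) = \<sigma> + Cone T" unfolding AT[symmetric] Cone_Un Cone_A ..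
  moreover have "\<sigma> \<inter> Cone T = {0}"
  proof -
    have "Cone A \<inter> Cone T = Cone (A \<inter> T)" using ind by (rule Cone_Int) (auto simp: T_def)
    moreover have "A \<inter> T = {}" unfolding T_def by blast
    ultimately show ?thesis using Cone_A Cone_empty by simp
  qed
  ultimately show ?thesis unfolding star_subdivision_def
    by (intro UnI2 CollectI bexI[of _ "Cone (S \<union> A)"] bexI[of _ "Cone T"] bexI[of _ y])
       (simp_all add: y(1))
qed

text \<open>Two sets of vectors may span the same cone. The point is that a face \<open>Q\<close> of the subdivided
complex contains every element of \<open>insert x G\<close> lying in \<open>Cone Q\<close>; hence \<open>Cone P = Cone Q\<close>
gives \<open>P \<subseteq> Q\<close>, and subsets of faces are faces.\<close>

lemma Cone_in_star_iff:
  assumes "P \<subseteq> insert x G"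
  shows "Cone P \<in> star \<longleftrightarrow> P \<in> stellar x A gen_complex"
proof
  assume "Cone P \<in> star"
  then obtain Q where Q: "Q \<in> stellar x A gen_complex" "Cone P = Cone Q"
    using star_subset[of "Cone P"] by blast
  have "g \<in> Q" if "g \<in> P" for g
  proof -
    have g: "g \<in> Cone Q" "g \<in> insert x G" using that Cone_superset Q(2) assms by auto
    from Q(1) show ?thesis
    proof (cases rule: stellar_cases)
      case old
      then have "g \<noteq> x" using carrier_of_x g(1) by blast
      then show ?thesis using complex_mem_Cone old g by blast
    next
      case (new S)
      then show ?thesis using new_cone_generators g by blast
    qed
  qed
  then show "P \<in> stellar x A gen_complex" using stellar_subset Q(1) by blast
next
  assume "P \<in> stellar x A gen_complex"
  then show "Cone P \<in> star" by (rule star_superset)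
qed

lemma fan_gens_star: "fan_gens N star = insert x G"
proof (rule antisym)
  have ray: "v \<in> fan_gens N star" if "primitive_in N v" "{v} \<in> stellar x A gen_complex" for v
  proof -
    have "v \<noteq> 0" using that(1) by (simp add: primitive_in_def)
    then have "dim (Cone {v}) = 1" by (simp add: dim_Cone dim_singleton)
    moreover have "Cone {v} \<in> star" using that(2) by (rule star_superset)
    ultimately show ?thesis unfolding fan_gens_def using that(1)
      by (intro CollectI conjI bexI[of _ "Cone {v}"]) simp_all
  qed
  have "{x} \<in> stellar x A gen_complex"
    using mem_stellar_new[of "{}"] A_nonempty A_face by simp
  moreover have "{g} \<in> stellar x A gen_complex" if "g \<in> G" for g
    using that gens_ray A_two unfolding stellar_def gen_complex_def by simp
  ultimately show "insert x G \<subseteq> fan_gens N star"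
    using ray x_primitive gens_primitive by blast
  show "fan_gens N star \<subseteq> insert x G"
  proof
    fix v assume "v \<in> fan_gens N star"
    then have v: "primitive_in N v" "Cone {v} \<in> star" unfolding fan_gens_def by auto
    obtain Q where Q: "Q \<in> stellar x A gen_complex" "Cone {v} = Cone Q"
      using star_subset[OF v(2)] by blast
    have QG: "Q \<subseteq> insert x G"
      using Q(1) by (cases rule: stellar_cases) (use vertices in blast)+
    have "v \<in> Q"
    proof (rule primitive_mem_of_Cone_eq_ray[OF lattice v(1) _ Q(2)])
      show "primitive_in N r" if "r \<in> Q" for r
        using that QG x_primitive gens_primitive by auto
    qed
    then show "v \<in> insert x G" using QG by blast
  qed
qed

lemma PC_star: "PC N star = minimal_nonfaces (insert x G) (stellar x A gen_complex)"
proof -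
  have "P \<noteq> {} \<and> P \<subseteq> insert x G \<and> Cone P \<notin> star \<and> (\<forall>y\<in>P. Cone (P - {y}) \<in> star) \<longleftrightarrow>
    P \<noteq> {} \<and> P \<subseteq> insert x G \<and> P \<notin> stellar x A gen_complex \<and> (\<forall>y\<in>P. P - {y} \<in> stellar x A gen_complex)"
    for P
  proof (cases "P \<subseteq> insert x G")
    case True
    then have "P - {y} \<subseteq> insert x G" for y by blast
    then show ?thesis using True Cone_in_star_iff by simp
  qed simp
  then show ?thesis unfolding PC_def minimal_nonfaces_def fan_gens_star by simp
qed

end

theorem theorem4p3:
  fixes N :: "'a::euclidean_space set"
    and \<Sigma> :: "'a set set"
    and \<sigma> :: "'a set"
    and x :: 'a
  assumes "full_lattice N"
    and "finite_fan N \<Sigma>" and "complete_fan \<Sigma>" and "simplicial_fan \<Sigma>"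
    and "\<sigma> \<in> \<Sigma>" and "2 \<le> dim \<sigma>" and "dim \<sigma> \<le> DIM('a)"
    and "primitive_in N x" and "x \<in> rel_interior \<sigma> \<inter> N"
  shows "PC N (star_subdivision N \<Sigma> \<sigma> x) =
           {cone_gens N \<Sigma> \<sigma>}
           \<union> {P \<in> PC N \<Sigma>. \<not> cone_gens N \<Sigma> \<sigma> \<subseteq> P}
           \<union> minimal_sets {(P - cone_gens N \<Sigma> \<sigma>) \<union> {x} | P.
                P \<in> PC N \<Sigma> \<and> P \<inter> cone_gens N \<Sigma> \<sigma> \<noteq> {}}"
proof -
  interpret fan_star_subdivision N \<Sigma> \<sigma> x
    by unfold_locales (use assms in auto)
  show ?thesis
    unfolding PC_star PC_eq_minimal_nonfaces by (rule minimal_nonfaces_stellar)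
qed

end
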